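(* Let $\alpha=\frac{m}{n}\cdot 360^\circ$ be a rational angle, where $m,n\in\mathbb{Z}$, $n\neq 0$, do not have any common factors (i.e. $\gcd(m,n)=1$). Then: (i) $\cos\alpha$ is a rational number if and only if $\varphi(|n|)\leq 2$, i.e. if and only if $|n|\in\{1,2,3,4,6\}$. (ii) For every integer $d>1$, $\cos\alpha$ is an algebraic number of degree $d$ (over $\mathbb{Q}$) if and only if $\varphi(|n|)=2d$.
   Context: $\varphi$ denotes Euler's totient function on positive integers. The angle $\alpha=\frac{m}{n}\cdot 360^\circ$ is $2\pi\frac{m}{n}$ in radians. *)

theory Defs
  imports "HOL-Analysis.Analysis" "HOL-Computational_Algebra.Computational_Algebra"
    "HOL-Number_Theory.Totient"
begin

definition is_min_poly_rat :: "rat poly \<Rightarrow> 'a :: field_char_0 \<Rightarrow> bool" where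
  "is_min_poly_rat p x \<longleftrightarrow>
     lead_coeff p = 1 \<and> poly (map_poly of_rat p) x = 0 \<and>
     (\<forall>q. q \<noteq> 0 \<and> poly (map_poly of_rat q) x = 0 \<longrightarrow> degree p \<le> degree q)"

(* A predicate rather than a degree function, so that transcendental numbers need no
   dummy value: they have no degree at all. *)
definition algebraic_of_degree :: "'a :: field_char_0 \<Rightarrow> nat \<Rightarrow> bool" where
  "algebraic_of_degree x d \<longleftrightarrow> (\<exists>p. is_min_poly_rat p x \<and> degree p = d)"

end

theory Submission
  imports Defs
begin

text \<open>
  Write \<open>N = \<bar>n\<bar>\<close> and \<open>c\<^sub>k = cos (2\<pi>k/N)\<close>. The theorem says in substance that the conjugates
  of \<open>c\<^sub>1\<close> over the rationals are exactly the \<open>c\<^sub>k\<close> with \<open>k\<close> coprime to \<open>N\<close>. For \<open>N > 2\<close> the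
  reflection \<open>k \<mapsto> N - k\<close> pairs these indices, so there are \<open>\<phi>(N)/2\<close> conjugates, and this is the degree
  of each of them; for \<open>N \<le> 2\<close> the cosine is \<open>\<plusminus>1\<close>. Rationality is the case of degree 1.

  That every such \<open>c\<^sub>k\<close> is a conjugate (\<open>rpoly_cos_conjugate\<close>) comes from the irreducibility of
  cyclotomic polynomials in the following form: a rational polynomial that vanishes at an \<open>N\<close>-th root
  of unity \<open>z\<close> vanishes at \<open>z ^ k\<close> for all \<open>k\<close> coprime to \<open>N\<close> (\<open>rpoly_root_conjugate\<close>). The argument is
  Landau's. If \<open>f\<close> has integer coefficients and \<open>f(z) = 0\<close>, then for a prime \<open>q\<close> the congruence
  \<open>f(X ^ q) \<equiv> f(X) ^ q\<close> modulo \<open>q\<close> shows that \<open>f(z ^ q)\<close> is \<open>q\<close> times an element of the ring generated by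
  \<open>z\<close>. This ring is a finitely generated additive group, so a nonzero element of it is divisible by
  few integers only (\<open>bounded_divisibility\<close>); and \<open>f(z ^ q)\<close> takes only finitely many values as \<open>q\<close>
  varies. Hence \<open>f(z ^ q) = 0\<close> for all large primes \<open>q\<close>, and every \<open>k\<close> coprime to \<open>N\<close> is congruent modulo
  \<open>N\<close> to a product of large primes.

  That there are no other conjugates (\<open>min_poly_cos_roots\<close>) is read off from the Chebyshev polynomials,
  which satisfy \<open>T\<^sub>N(cos t) = cos (N t)\<close>: the minimal polynomial divides \<open>T\<^sub>N - 1\<close>, whose
  complex roots are the \<open>c\<^sub>k\<close>, and if \<open>g = gcd k N > 1\<close> then \<open>c\<^sub>k\<close> is a root of \<open>T\<^sub>N\<^sub>/\<^sub>g - 1\<close> whereas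
  \<open>c\<^sub>1\<close> is not.
\<close>

section \<open>Evaluating a polynomial along a homomorphism of coefficients\<close>

locale poly_coeff_hom =
  fixes h :: "'r :: comm_ring_1 \<Rightarrow> 'a :: comm_ring_1"
  assumes h_add: "h (x + y) = h x + h y"
    and h_mult: "h (x * y) = h x * h y"
    and h_one: "h 1 = 1"
begin

abbreviation "ev p x \<equiv> poly (map_poly h p) x"

lemma h_zero: "h 0 = 0"
  using h_add[of 0 0] by simp

lemma h_minus: "h (- x) = - h x"
  using h_add[of x "- x"] h_zero by (simp add: eq_neg_iff_add_eq_0 add.commute)

lemma ev_pCons: "ev (pCons a p) x = h a + x * ev p x"
  by (simp add: map_poly_pCons h_zero)

lemma ev_add: "ev (p + q) x = ev p x + ev q x"
proof -
  have "map_poly h (p + q) = map_poly h p + map_poly h q"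
    by (rule poly_eqI) (simp add: coeff_map_poly h_zero h_add)
  then show ?thesis by simp
qed

lemma ev_minus: "ev (- p) x = - ev p x"
proof -
  have "map_poly h (- p) = - map_poly h p"
    by (rule poly_eqI) (simp add: coeff_map_poly h_zero h_minus)
  then show ?thesis by simp
qed

lemma ev_diff: "ev (p - q) x = ev p x - ev q x"
  using ev_add[of p "- q" x] by (simp add: ev_minus)

lemma ev_smult: "ev (smult c p) x = h c * ev p x"
  by (simp add: map_poly_smult h_zero h_mult)

lemma ev_mult: "ev (p * q) x = ev p x * ev q x"
  by (induction p) (simp_all add: ev_add ev_smult ev_pCons h_zero algebra_simps)

lemma ev_one: "ev 1 x = 1"
  by (simp add: h_one)

lemma ev_power: "ev (p ^ k) x = ev p x ^ k"
  by (induction k) (simp_all only: power_0 power_Suc ev_one ev_mult)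

lemma ev_of_nat: "ev (of_nat k) x = of_nat k"
  by (induction k) (simp_all add: ev_add h_one)

lemma ev_monom: "ev (monom 1 k) x = x ^ k"
  by (simp add: map_poly_monom h_zero h_one poly_monom)

lemma ev_pcompose: "ev (p \<circ>\<^sub>p q) x = ev p (ev q x)"
  by (induction p) (simp_all add: pcompose_pCons ev_add ev_mult ev_pCons h_zero)

end

interpretation ipoly: poly_coeff_hom "of_int :: int \<Rightarrow> 'a :: comm_ring_1"
  by unfold_locales simp_all

interpretation rpoly: poly_coeff_hom "of_rat :: rat \<Rightarrow> 'a :: field_char_0"
  by unfold_locales (simp_all add: of_rat_add of_rat_mult)

section \<open>Divisibility in finitely generated groups\<close>

lemma common_denominator:
  fixes A :: "rat set"
  assumes "finite A"
  shows "\<exists>D::nat. D > 0 \<and> (\<forall>x\<in>A. of_nat D * x \<in> \<int>)"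
  using assms
proof (induction A rule: finite_induct)
  case empty
  then show ?case by (intro exI[of _ 1]) simp
next
  case (insert x A)
  then obtain D :: nat where D: "D > 0" "\<And>y. y \<in> A \<Longrightarrow> of_nat D * y \<in> \<int>" by blast
  obtain a b :: int where ab: "b > 0" "x = of_int a / of_int b"
    by (metis Fract_of_int_quotient Rat_cases)
  have 1: "of_nat (D * nat b) * y \<in> \<int>" if "y \<in> A" for y
  proof -
    have "of_nat (D * nat b) * y = of_nat (nat b) * (of_nat D * y)" by simp
    also have "\<dots> \<in> \<int>" using D(2)[OF that] by (rule Ints_mult[rotated]) simp
    finally show ?thesis .
  qed
  have "of_nat (D * nat b) * x = of_int (int D * a)" using ab by simp
  then have "of_nat (D * nat b) * x \<in> \<int>" by (metis Ints_of_int)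
  moreover have "D * nat b > 0" using D(1) ab(1) by simp
  ultimately show ?case using 1 by blast
qed

text \<open>A rational linear functional \<open>g\<close> with \<open>g v = 1\<close> maps the group generated by the \<open>e i\<close> into the
  fractions with some fixed denominator \<open>D\<close>. If \<open>v\<close> is \<open>q\<close> times an element of this group, then
  \<open>1\<close> is \<open>q\<close> times such a fraction, so \<open>q\<close> divides \<open>D\<close>.\<close>

lemma bounded_divisibility:
  fixes v :: "'a :: field_char_0" and e :: "nat \<Rightarrow> 'a"
  assumes "v \<noteq> 0"
  shows "\<exists>D>0. \<forall>(q::nat) a :: nat \<Rightarrow> int.
           v = of_nat q * (\<Sum>i<n. of_int (a i) * e i) \<longrightarrow> q dvd D"
proof -
  interpret vector_space_pair "\<lambda>(r::rat) (x::'a). of_rat r * x" "(*) :: rat \<Rightarrow> rat \<Rightarrow> rat"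
    by unfold_locales (auto simp: algebra_simps of_rat_add of_rat_mult)
  have "vs1.independent {v}"
    using assms by simp
  from linear_independent_extend[OF this, of "\<lambda>_. 1"]
  obtain g where g: "Vector_Spaces.linear (\<lambda>(r::rat) (x::'a). of_rat r * x) (*) g" and gv: "g v = 1"
    by auto
  interpret g: Vector_Spaces.linear "\<lambda>(r::rat) (x::'a). of_rat r * x" "(*)" g by fact
  obtain D :: nat where D: "D > 0" "\<And>i. i < n \<Longrightarrow> of_nat D * g (e i) \<in> \<int>"
    using common_denominator[of "(g \<circ> e) ` {..<n}"] by auto
  have "q dvd D" if q: "v = of_nat q * (\<Sum>i<n. of_int (a i) * e i)" for q and a :: "nat \<Rightarrow> int"
  proof -
    have gs: "g (of_rat r * x) = r * g x" for r x by (rule g.scale)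
    have "1 = g (of_rat (of_nat q) * (\<Sum>i<n. of_rat (of_int (a i)) * e i))"
      using gv q by simp
    also have "\<dots> = of_nat q * (\<Sum>i<n. of_int (a i) * g (e i))"
      unfolding gs g.sum ..
    finally have "of_nat D = of_nat D * (of_nat q * (\<Sum>i<n. of_int (a i) * g (e i)))"
      by (metis mult.right_neutral)
    also have "\<dots> = of_nat q * (\<Sum>i<n. of_int (a i) * (of_nat D * g (e i)))"
      by (simp add: sum_distrib_left mult_ac)
    finally have "of_nat D = of_nat q * (\<Sum>i<n. of_int (a i) * (of_nat D * g (e i)))" .
    moreover have "(\<Sum>i<n. of_int (a i) * (of_nat D * g (e i))) \<in> \<int>"
      using D(2) by (intro Ints_sum Ints_mult[OF Ints_of_int]) simp
    then obtain z where "(\<Sum>i<n. of_int (a i) * (of_nat D * g (e i))) = of_int z"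
      by (auto elim: Ints_cases)
    ultimately have "(of_int (int D) :: rat) = of_int (int q * z)" by simp
    then have "int D = int q * z" by (simp only: of_int_eq_iff)
    then show "q dvd D" by (metis dvd_triv_left int_dvd_int_iff)
  qed
  with D(1) show ?thesis by blast
qed

section \<open>The Frobenius congruence for integer polynomials\<close>

lemma freshman_dvd:
  fixes x y :: "'a :: comm_ring_1"
  assumes "prime q"
  shows "of_nat q dvd (x + y) ^ q - (x ^ q + y ^ q)"
proof -
  have q: "q > 0" using assms prime_gt_0_nat by blast
  have "{..q} = insert 0 (insert q {0<..<q})" using q by auto
  then have "(x + y) ^ q = x ^ q + y ^ q + (\<Sum>k\<in>{0<..<q}. of_nat (q choose k) * x ^ k * y ^ (q - k))"
    using q by (simp add: binomial_ring algebra_simps)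
  moreover have "of_nat q dvd (of_nat (q choose k) :: 'a)" if "k \<in> {0<..<q}" for k
  proof -
    have "q dvd q choose k" using that assms by (intro dvd_choose_prime) auto
    then show ?thesis by (metis dvd_def of_nat_mult)
  qed
  then have "of_nat q dvd (\<Sum>k\<in>{0<..<q}. of_nat (q choose k) * x ^ k * y ^ (q - k))"
    by (intro dvd_sum dvd_mult2)
  ultimately show ?thesis by simp
qed

lemma fermat_int:
  fixes a :: int
  assumes "prime q"
  shows "of_nat q dvd a ^ q - a"
proof (induction a rule: int_induct[where k = 0])
  case base
  then show ?case using assms prime_gt_0_nat by (simp add: zero_power)
next
  case (step1 i)
  have "(i + 1) ^ q - (i + 1) = ((i + 1) ^ q - (i ^ q + 1 ^ q)) + (i ^ q - i)" by simp
  then show ?case using freshman_dvd[OF assms, of i 1] step1 by (metis dvd_add)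
next
  case (step2 i)
  have "(i - 1) ^ q - (i - 1) = (i ^ q - i) - ((i - 1 + 1) ^ q - ((i - 1) ^ q + 1 ^ q))" by simp
  then show ?case using freshman_dvd[OF assms, of "i - 1" 1] step2 by (metis dvd_diff)
qed

lemma frobenius_int_poly:
  fixes f :: "int poly"
  assumes "prime q"
  shows "of_nat q dvd f ^ q - (f \<circ>\<^sub>p monom 1 q)"
proof (induction f)
  case 0
  then show ?case using assms prime_gt_0_nat by (simp add: zero_power)
next
  case (pCons a f)
  let ?X = "monom 1 1 :: int poly"
  have eq: "pCons a f = [:a:] + ?X * f" by (simp add: monom_altdef)
  have "of_nat q dvd [:a ^ q - a:]"
  proof -
    obtain b where "a ^ q - a = of_nat q * b" using fermat_int[OF assms, of a] by blast
    then have "[:a ^ q - a:] = of_nat q * [:b:]" by (simp add: of_nat_poly)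
    then show ?thesis by (rule dvdI)
  qed
  then have "of_nat q dvd [:a:] ^ q - [:a:]" by (simp add: poly_const_pow)
  moreover have "of_nat q dvd ?X ^ q * (f ^ q - (f \<circ>\<^sub>p monom 1 q))"
    using pCons.IH by (rule dvd_mult)
  moreover note freshman_dvd[OF assms, of "[:a:]" "?X * f"]
  moreover have "pCons a f ^ q - (pCons a f \<circ>\<^sub>p monom 1 q) =
      (([:a:] + ?X * f) ^ q - ([:a:] ^ q + (?X * f) ^ q)) + ([:a:] ^ q - [:a:]) +
      ?X ^ q * (f ^ q - (f \<circ>\<^sub>p monom 1 q))"
    unfolding pcompose_pCons eq[symmetric] by (simp add: algebra_simps monom_power power_mult_distrib)
  ultimately show ?case by (simp only: dvd_add)
qed

section \<open>Conjugates of roots of unity\<close>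

lemma root_of_unity_power_cong:
  fixes z :: "'a :: field_char_0"
  assumes "z ^ n = 1" "[j = k] (mod n)"
  shows "z ^ j = z ^ k"
proof -
  have "z ^ i = z ^ (i mod n)" for i
  proof -
    have "z ^ i = z ^ (n * (i div n) + i mod n)" by simp
    then show ?thesis unfolding power_add power_mult using assms by simp
  qed
  then show ?thesis using assms(2) unfolding cong_def by metis
qed

lemma ipoly_root_of_unity:
  fixes z :: "'a :: field_char_0"
  assumes "z ^ n = 1" "n > 0"
  shows "\<exists>a::nat \<Rightarrow> int. ipoly.ev f z = (\<Sum>i<n. of_int (a i) * z ^ i)"
proof -
  define a where "a i = (\<Sum>j | j \<le> degree f \<and> j mod n = i. coeff f j)" for i
  have "ipoly.ev f z = (\<Sum>j\<le>degree f. of_int (coeff f j) * z ^ j)"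
    by (simp add: poly_altdef degree_map_poly coeff_map_poly)
  also have "\<dots> = (\<Sum>i<n. \<Sum>j | j \<in> {..degree f} \<and> j mod n = i. of_int (coeff f j) * z ^ j)"
    by (rule sum.group[symmetric]) (use assms in auto)
  also have "\<dots> = (\<Sum>i<n. of_int (a i) * z ^ i)"
    unfolding a_def of_int_sum sum_distrib_right
    by (intro sum.cong refl arg_cong2[of _ _ _ _ "(*)"] root_of_unity_power_cong[OF assms(1)])
      (auto simp: cong_def)
  finally show ?thesis by blast
qed

text \<open>The bound \<open>A\<close> must serve all roots \<open>z\<close> of \<open>f\<close> among the \<open>n\<close>-th roots of unity simultaneously,
  because the lemma is iterated: after passing from \<open>z\<close> to \<open>z ^ q\<close>, the next prime is applied to
  \<open>z ^ q\<close>. This is possible since the values \<open>f(z ^ q)\<close> and the rings generated by such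
  \<open>z\<close> range over finite collections.\<close>

lemma root_power_large_prime:
  fixes f :: "int poly"
  assumes n: "n > 0"
  shows "\<exists>A. \<forall>q z :: 'a :: field_char_0. prime q \<and> q > A \<and> z ^ n = 1 \<and> ipoly.ev f z = 0 \<longrightarrow>
                 ipoly.ev f (z ^ q) = 0"
proof -
  let ?U = "{z :: 'a. z ^ n = 1}"
  have U: "finite ?U"
  proof -
    have "monom 1 n - 1 \<noteq> (0 :: 'a poly)" using n by (simp add: monom_eq_1_iff)
    then have "finite {z. poly (monom 1 n - 1 :: 'a poly) z = 0}" by (rule poly_roots_finite)
    then show ?thesis by (simp add: poly_monom)
  qed
  let ?V = "{v \<in> ipoly.ev f ` ?U. v \<noteq> 0}"
  define bound where "bound z v D \<longleftrightarrow> D > 0 \<and> (\<forall>(q::nat) a :: nat \<Rightarrow> int.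
      v = of_nat q * (\<Sum>i<n. of_int (a i) * z ^ i) \<longrightarrow> q dvd D)" for z v :: 'a and D :: nat
  define D where "D z v = (SOME D. bound z v D)" for z v
  have bound: "bound z v (D z v)" if "v \<noteq> 0" for z v
    unfolding D_def by (rule someI_ex) (use bounded_divisibility[OF that] in \<open>simp add: bound_def\<close>)
  define A where "A = (\<Sum>(z, v)\<in>?U \<times> ?V. D z v)"
  have A: "D z v \<le> A" if "z \<in> ?U" "v \<in> ?V" for z v
  proof -
    have "(\<lambda>(z, v). D z v) (z, v) \<le> A" unfolding A_def
      by (rule member_le_sum) (use U that in auto)
    then show ?thesis by simp
  qed
  have "ipoly.ev f (z ^ q) = 0" if q: "prime q" "q > A" and z: "z ^ n = 1" "ipoly.ev f z = 0" for q and z :: 'a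
  proof (rule ccontr)
    let ?v = "ipoly.ev f (z ^ q)"
    assume nz: "?v \<noteq> 0"
    have "(z ^ q) ^ n = 1" using z by (metis mult.commute power_mult power_one)
    then have v: "?v \<in> ?V" using nz by blast
    obtain g where g: "f ^ q - (f \<circ>\<^sub>p monom 1 q) = of_nat q * g"
      using frobenius_int_poly[OF q(1), of f] by blast
    have "ipoly.ev (f ^ q - (f \<circ>\<^sub>p monom 1 q)) z = - ?v"
      using z q(1) prime_gt_0_nat
      by (simp add: ipoly.ev_diff ipoly.ev_power ipoly.ev_pcompose ipoly.ev_monom zero_power)
    then have "?v = of_nat q * ipoly.ev (- g) z"
      unfolding g ipoly.ev_mult ipoly.ev_of_nat ipoly.ev_minus by simp
    moreover obtain a :: "nat \<Rightarrow> int" where "ipoly.ev (- g) z = (\<Sum>i<n. of_int (a i) * z ^ i)"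
      using ipoly_root_of_unity[OF z(1) n] by blast
    ultimately have "q dvd D z ?v" "D z ?v > 0" using bound[OF nz, of z] unfolding bound_def by auto
    then have "q \<le> D z ?v" by (rule dvd_imp_le)
    also have "\<dots> \<le> A" using A z(1) v by blast
    finally show False using q(2) by simp
  qed
  then show ?thesis by blast
qed

text \<open>Adding to \<open>k\<close> the product of \<open>n\<close> and all small primes not dividing \<open>k\<close> works: a small prime
  divides exactly one of the two summands.\<close>

lemma cong_avoiding_small_primes:
  assumes "coprime k n" "n > 0"
  shows "\<exists>k'::nat. k' > 0 \<and> [k' = k] (mod n) \<and> (\<forall>p. prime p \<and> p dvd k' \<longrightarrow> p > A)"
proof -
  let ?P = "{p. prime p \<and> p \<le> A \<and> \<not> p dvd k}"
  have fin: "finite ?P" by (rule finite_subset[of _ "{..A}"]) auto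
  define k' where "k' = k + n * \<Prod>?P"
  have "\<Prod>?P > 0" by (rule prod_pos) (auto simp: prime_gt_0_nat)
  then have "k' > 0" using assms by (simp add: k'_def)
  moreover have "[k' = k] (mod n)" by (simp add: k'_def cong_def)
  moreover have "p > A" if p: "prime p" "p dvd k'" for p
  proof (rule ccontr)
    assume "\<not> p > A"
    show False
    proof (cases "p dvd k")
      case True
      then have "p dvd n * \<Prod>?P" using p(2) by (simp add: k'_def dvd_add_right_iff)
      moreover have "\<not> p dvd n" using True p(1) assms(1) coprime_common_divisor not_prime_unit by blast
      ultimately have "p dvd \<Prod>?P" using p(1) prime_dvd_mult_iff by blast
      then obtain r where "r \<in> ?P" "p dvd r" using prime_dvd_prod_iff[OF fin p(1), of "\<lambda>x. x"] by auto
      then show False using p(1) True primes_dvd_imp_eq by blast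
    next
      case False
      then have "p \<in> ?P" using p \<open>\<not> p > A\<close> by simp
      then have "p dvd \<Prod>?P" using fin dvd_prodI[of ?P p "\<lambda>x. x"] by simp
      then show False using False p(2) by (simp add: k'_def dvd_add_left_iff)
    qed
  qed
  ultimately show ?thesis by blast
qed

lemma ipoly_root_conjugate:
  fixes z :: "'a :: field_char_0" and f :: "int poly"
  assumes z: "z ^ n = 1" and n: "n > 0" and f: "ipoly.ev f z = 0" and k: "coprime k n"
  shows "ipoly.ev f (z ^ k) = 0"
proof -
  obtain A where A: "\<And>q z :: 'a. prime q \<Longrightarrow> q > A \<Longrightarrow> z ^ n = 1 \<Longrightarrow> ipoly.ev f z = 0 \<Longrightarrow>
                 ipoly.ev f (z ^ q) = 0"
    using root_power_large_prime[OF n, of f] by blast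
  have step: "ipoly.ev f (w ^ k) = 0"
    if "k > 0" "\<forall>p. prime p \<and> p dvd k \<longrightarrow> p > A" "w ^ n = 1" "ipoly.ev f w = 0" for k and w :: 'a
    using that
  proof (induction k arbitrary: w rule: less_induct)
    case (less k)
    show ?case
    proof (cases "k = 1")
      case True
      then show ?thesis using less.prems by simp
    next
      case False
      then obtain p where p: "prime p" "p dvd k" using prime_factor_nat by blast
      then obtain r where r: "k = p * r" by blast
      have "(w ^ p) ^ n = 1" using less.prems by (metis mult.commute power_mult power_one)
      moreover have "ipoly.ev f (w ^ p) = 0" using A p less.prems by blast
      moreover have "r < k" "r > 0" using less.prems(1) p(1) prime_gt_1_nat r by auto
      ultimately have "ipoly.ev f ((w ^ p) ^ r) = 0"
        using less.IH[of r "w ^ p"] less.prems(2) r by simp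
      then show ?thesis by (simp add: r power_mult)
    qed
  qed
  obtain k' where k': "k' > 0" "[k' = k] (mod n)" "\<forall>p. prime p \<and> p dvd k' \<longrightarrow> p > A"
    using cong_avoiding_small_primes[OF k n] by blast
  then have "ipoly.ev f (z ^ k') = 0" using step z f by blast
  then show ?thesis using root_of_unity_power_cong[OF z k'(2)] by simp
qed

lemma clear_denominators:
  fixes p :: "rat poly"
  obtains D f where "D \<noteq> 0" "map_poly of_int f = smult D p"
proof -
  obtain D :: nat where D: "D > 0" "\<And>i. i \<le> degree p \<Longrightarrow> of_nat D * coeff p i \<in> \<int>"
    using common_denominator[of "coeff p ` {..degree p}"] by auto
  let ?f = "map_poly floor (smult (of_nat D) p)"
  have "of_nat D * coeff p i \<in> \<int>" for i
    using D(2)[of i] by (cases "i \<le> degree p") (simp_all add: coeff_eq_0)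
  then have "map_poly of_int ?f = smult (of_nat D) p"
    by (intro poly_eqI) (simp add: coeff_map_poly)
  with that[of "of_nat D" ?f] D(1) show thesis by simp
qed

text \<open>For \<open>z\<close> primitive and \<open>p\<close> its minimal polynomial, this gives \<open>p\<close> all primitive \<open>n\<close>-th roots of
  unity as roots, which is the irreducibility of the \<open>n\<close>-th cyclotomic polynomial over the rationals.\<close>

lemma rpoly_root_conjugate:
  fixes z :: "'a :: field_char_0" and p :: "rat poly"
  assumes z: "z ^ n = 1" and n: "n > 0" and p: "rpoly.ev p z = 0" and k: "coprime k n"
  shows "rpoly.ev p (z ^ k) = 0"
proof -
  obtain D f where D: "D \<noteq> 0" and f: "map_poly of_int f = smult D p"
    by (rule clear_denominators)
  have *: "ipoly.ev f x = of_rat D * rpoly.ev p x" for x :: 'a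
  proof -
    have "map_poly of_int f = (map_poly of_rat (map_poly of_int f) :: 'a poly)"
      by (simp add: map_poly_map_poly o_def)
    then show ?thesis unfolding f by (simp add: rpoly.ev_smult)
  qed
  have "ipoly.ev f (z ^ k) = 0"
    by (rule ipoly_root_conjugate[OF z n _ k]) (simp add: * p)
  then show ?thesis using D by (simp add: *)
qed

lemma rpoly_dvd_root:
  assumes "p dvd q" "rpoly.ev p x = 0"
  shows "rpoly.ev q x = 0"
  using assms by (auto simp: rpoly.ev_mult elim!: dvdE)

section \<open>Minimal polynomials over the rationals\<close>

lemma min_poly_ratD:
  assumes "is_min_poly_rat p x"
  shows "p \<noteq> 0" and "lead_coeff p = 1" and "rpoly.ev p x = 0"
    and "\<And>q. q \<noteq> 0 \<Longrightarrow> rpoly.ev q x = 0 \<Longrightarrow> degree p \<le> degree q"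
  using assms unfolding is_min_poly_rat_def by auto

lemma min_poly_rat_exists:
  assumes "q \<noteq> 0" "rpoly.ev q x = 0"
  shows "\<exists>p. is_min_poly_rat p x"
proof -
  obtain p where p: "p \<noteq> 0 \<and> rpoly.ev p x = 0"
    and minimal: "\<And>r. r \<noteq> 0 \<and> rpoly.ev r x = 0 \<Longrightarrow> degree p \<le> degree r"
    using ex_has_least_nat[of "\<lambda>p. p \<noteq> 0 \<and> rpoly.ev p x = 0" q degree] assms by blast
  have "is_min_poly_rat (smult (inverse (lead_coeff p)) p) x"
    unfolding is_min_poly_rat_def using p minimal by (auto simp: rpoly.ev_smult)
  then show ?thesis ..
qed

lemma min_poly_rat_dvd:
  assumes p: "is_min_poly_rat p x" and q: "rpoly.ev q x = 0"
  shows "p dvd q"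
proof (rule ccontr)
  assume "\<not> p dvd q"
  then have nz: "q mod p \<noteq> 0" by (simp add: dvd_eq_mod_eq_0)
  have p0: "p \<noteq> 0" and px: "rpoly.ev p x = 0" using p by (auto simp: is_min_poly_rat_def)
  have "rpoly.ev (q mod p) x = 0"
    using rpoly.ev_diff[of q "q div p * p" x] px q by (simp add: minus_div_mult_eq_mod rpoly.ev_mult)
  then have "degree p \<le> degree (q mod p)" using p nz by (auto simp: is_min_poly_rat_def)
  then show False using degree_mod_less[OF p0, of q] nz by simp
qed

lemma degree_min_poly_pos:
  assumes "is_min_poly_rat p x"
  shows "degree p > 0"
proof (rule ccontr)
  assume "\<not> degree p > 0"
  then obtain c where "p = [:c:]" using degree_eq_zeroE by auto
  then show False using assms by (auto simp: is_min_poly_rat_def rpoly.ev_pCons)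
qed

text \<open>Irreducibility of minimal polynomials: if \<open>g\<close> is the minimal polynomial of \<open>y\<close> then \<open>p = g * r\<close>, and
  \<open>r\<close> cannot vanish at \<open>x\<close> because its degree is too small; so \<open>g\<close> vanishes at \<open>x\<close> and has
  at least the degree of \<open>p\<close>. The two points may lie in different fields, which lets real numbers be
  compared with complex roots below.\<close>

lemma min_poly_rat_other_root:
  assumes p: "is_min_poly_rat p x" and y: "rpoly.ev p y = 0"
  shows "is_min_poly_rat p y"
proof -
  have p0: "p \<noteq> 0" and px: "rpoly.ev p x = 0"
    and minimal: "\<And>r. r \<noteq> 0 \<Longrightarrow> rpoly.ev r x = 0 \<Longrightarrow> degree p \<le> degree r"
    using p unfolding is_min_poly_rat_def by auto
  obtain g where g: "is_min_poly_rat g y" using min_poly_rat_exists[OF p0 y] by blast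
  obtain r where r: "p = g * r" using min_poly_rat_dvd[OF g y] by (rule dvdE)
  have nz: "g \<noteq> 0" "r \<noteq> 0" using p0 r by auto
  have deg: "degree p = degree g + degree r" unfolding r using nz by (rule degree_mult_eq)
  have "rpoly.ev r x \<noteq> 0" using minimal[OF nz(2)] deg degree_min_poly_pos[OF g] by auto
  then have "rpoly.ev g x = 0" using px by (simp add: r rpoly.ev_mult)
  then have "degree p \<le> degree g" using minimal[OF nz(1)] by simp
  then show ?thesis using p y g unfolding is_min_poly_rat_def by (auto intro: order_trans)
qed

lemma algebraic_of_degree_iff:
  assumes "is_min_poly_rat p x"
  shows "algebraic_of_degree x d \<longleftrightarrow> d = degree p"
proof
  assume "algebraic_of_degree x d"
  then obtain q where q: "is_min_poly_rat q x" "degree q = d"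
    unfolding algebraic_of_degree_def by blast
  have "degree p = degree q"
    using min_poly_ratD[OF assms] min_poly_ratD[OF q(1)] by (intro antisym) auto
  with q(2) show "d = degree p" by simp
qed (use assms in \<open>auto simp: algebraic_of_degree_def\<close>)

lemma rational_iff_degree_min_poly_1:
  fixes x :: real
  assumes p: "is_min_poly_rat p x"
  shows "x \<in> \<rat> \<longleftrightarrow> degree p = 1"
proof
  assume "x \<in> \<rat>"
  then obtain r where "x = of_rat r" by (rule Rats_cases)
  then have "rpoly.ev [:- r, 1:] x = 0" by (simp add: rpoly.ev_pCons rpoly.h_zero of_rat_minus)
  moreover have "[:- r, 1:] \<noteq> 0" by simp
  ultimately have "degree p \<le> degree [:- r, 1:]" using p unfolding is_min_poly_rat_def by metis
  then show "degree p = 1" using degree_min_poly_pos[OF p] by simp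
next
  assume "degree p = 1"
  then obtain a q where "p = pCons a q" "degree q = 0"
    by (cases p) (auto split: if_splits)
  then obtain b where ab: "p = [:a, b:]" by (auto elim: degree_eq_zeroE)
  have "b = 1" using \<open>degree p = 1\<close> min_poly_ratD(2)[OF p] ab by simp
  then have "of_rat a + x = 0"
    using min_poly_ratD(3)[OF p] ab by (simp add: rpoly.ev_pCons rpoly.h_zero)
  then have "x = of_rat (- a)" by (simp add: of_rat_minus)
  then show "x \<in> \<rat>" by simp
qed

text \<open>The roots are simple: at a multiple root the derivative would vanish as well, so \<open>p\<close>, being also
  the minimal polynomial of that root, would divide its own derivative.\<close>

lemma degree_min_poly_eq_card_roots:
  assumes p: "is_min_poly_rat p x"
  shows "degree p = card {z :: complex. rpoly.ev p z = 0}"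
proof -
  let ?P = "map_poly of_rat p :: complex poly"
  have deg: "degree ?P = degree p" by (rule degree_map_poly) simp
  have pd: "pderiv ?P = map_poly of_rat (pderiv p)"
    by (rule poly_eqI) (simp add: coeff_pderiv coeff_map_poly of_rat_mult of_rat_add)
  have pos: "degree p > 0" by (rule degree_min_poly_pos[OF p])
  have "\<not> (poly ?P a = 0 \<and> poly (pderiv ?P) a = 0)" for a
  proof
    assume "poly ?P a = 0 \<and> poly (pderiv ?P) a = 0"
    then have "rpoly.ev p a = 0" "rpoly.ev (pderiv p) a = 0" by (simp_all add: pd)
    then have "p dvd pderiv p" using min_poly_rat_dvd[OF min_poly_rat_other_root[OF p]] by blast
    moreover have "pderiv p \<noteq> 0" using pos by (simp add: pderiv_eq_0_iff)
    ultimately have "degree p \<le> degree (pderiv p)" by (rule dvd_imp_degree_le)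
    then show False using pos by (simp add: degree_pderiv)
  qed
  then have "rsquarefree ?P" by (simp add: rsquarefree_roots)
  from complex_poly_decompose_rsquarefree[OF this]
  have "degree ?P = degree (smult (lead_coeff ?P) (\<Prod>z|poly ?P z = 0. [:- z, 1:]))" by simp
  also have "\<dots> = card {z. poly ?P z = 0}"
  proof -
    have "lead_coeff ?P \<noteq> 0" using min_poly_ratD(2)[OF p] by (simp add: deg coeff_map_poly)
    then have "degree (smult (lead_coeff ?P) (\<Prod>z|poly ?P z = 0. [:- z, 1:])) =
        degree (\<Prod>z|poly ?P z = 0. [:- z, 1:])" by (rule degree_smult_eq[THEN trans, OF if_not_P])
    also have "\<dots> = card {z. poly ?P z = 0}" by (simp add: degree_prod_sum_eq)
    finally show ?thesis .
  qed
  finally show ?thesis by (simp add: deg)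
qed

lemma rpoly_of_real:
  fixes x :: real
  shows "rpoly.ev p (complex_of_real x) = of_real (rpoly.ev p x)"
proof (induction p)
  case (pCons a p)
  have "complex_of_rat a = of_real (of_rat a)"
    by (cases a) (simp add: of_rat_rat)
  with pCons show ?case by (simp add: rpoly.ev_pCons)
qed simp

section \<open>Chebyshev polynomials\<close>

fun chebyshev :: "nat \<Rightarrow> rat poly" where
  "chebyshev 0 = 1"
| "chebyshev (Suc 0) = [:0, 1:]"
| "chebyshev (Suc (Suc n)) = [:0, 2:] * chebyshev (Suc n) - chebyshev n"

text \<open>Every complex number has the form \<open>(w + inverse w) / 2\<close>, so this form of \<open>T\<^sub>n(cos t) = cos (n t)\<close>
  also determines the values of the Chebyshev polynomials off the real interval from -1 to 1.\<close>

lemma ev_chebyshev: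
  fixes w :: "'a :: field_char_0"
  assumes "w \<noteq> 0"
  shows "rpoly.ev (chebyshev n) ((w + inverse w) / 2) = (w ^ n + inverse w ^ n) / 2"
proof (induction n rule: chebyshev.induct)
  case (3 n)
  define u where "u = inverse w"
  have "w * u = 1" using assms by (simp add: u_def)
  have "(w + u) * (w ^ Suc n + u ^ Suc n) =
      w ^ Suc (Suc n) + u ^ Suc (Suc n) + (w * u) * (w ^ n + u ^ n)"
    by (simp add: algebra_simps)
  then have "(w + u) * (w ^ Suc n + u ^ Suc n) - (w ^ n + u ^ n) =
      w ^ Suc (Suc n) + u ^ Suc (Suc n)"
    unfolding \<open>w * u = 1\<close> by simp
  moreover have "rpoly.ev (chebyshev (Suc (Suc n))) ((w + u) / 2) =
      ((w + u) * (w ^ Suc n + u ^ Suc n) - (w ^ n + u ^ n)) / 2"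
    unfolding chebyshev.simps rpoly.ev_diff rpoly.ev_mult 3[folded u_def]
    by (simp add: rpoly.ev_pCons rpoly.h_zero diff_divide_distrib)
  ultimately show ?case unfolding u_def by simp
qed (simp_all add: rpoly.ev_pCons rpoly.h_zero)

lemma cos_eq_cis: "complex_of_real (cos t) = (cis t + inverse (cis t)) / 2"
  by (simp add: complex_eq_iff)

lemma ev_chebyshev_cos: "rpoly.ev (chebyshev n) (cos t) = cos (real n * t)"
proof -
  have "complex_of_real (rpoly.ev (chebyshev n) (cos t)) = (cis t ^ n + inverse (cis t) ^ n) / 2"
    unfolding rpoly_of_real[symmetric] cos_eq_cis by (rule ev_chebyshev) simp
  also have "\<dots> = complex_of_real (cos (real n * t))"
    unfolding cos_eq_cis power_inverse Complex.DeMoivre ..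
  finally show ?thesis by (simp only: of_real_eq_iff)
qed

lemma chebyshev_eq_1:
  assumes n: "n > 0" and z: "rpoly.ev (chebyshev n) z = (1 :: complex)"
  shows "\<exists>k::nat. z = of_real (cos (2 * pi * real k / real n))"
proof -
  \<comment> \<open>With this \<open>s\<close>, the sum \<open>z + s\<close> is a root \<open>w\<close> of \<open>w\<^sup>2 - 2 z w + 1\<close>, that is, \<open>z = (w + inverse w) / 2\<close>.\<close>
  obtain s where s: "s\<^sup>2 = z\<^sup>2 - 1" using power2_csqrt by blast
  define w where "w = z + s"
  have w1: "w * (z - s) = 1" using s by (simp add: w_def algebra_simps power2_eq_square)
  then have w0: "w \<noteq> 0" and iw: "inverse w = z - s" by (auto simp: inverse_unique)
  then have zw: "z = (w + inverse w) / 2" by (simp add: w_def)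
  have "(w ^ n + inverse w ^ n) / 2 = 1"
    using ev_chebyshev[OF w0, of n] z zw by simp
  then have "w ^ n + inverse (w ^ n) = 2" by (simp add: power_inverse)
  then have "(w ^ n - 1)\<^sup>2 = 0" using w0 by (simp add: field_simps power2_eq_square)
  then have "w ^ n = 1" by simp
  then obtain k where "w = cis (2 * pi * real k / real n)"
    using Complex.bij_betw_roots_unity[OF n] unfolding bij_betw_def by auto
  then have "z = of_real (cos (2 * pi * real k / real n))" unfolding cos_eq_cis using zw by simp
  then show ?thesis ..
qed

lemma chebyshev_neq_1:
  assumes "n > 0"
  shows "chebyshev n - 1 \<noteq> 0"
proof
  assume "chebyshev n - 1 = 0"
  then have "rpoly.ev (chebyshev n) (cos (pi / real n)) = 1" by simp
  then show False using assms unfolding ev_chebyshev_cos by simp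
qed

section \<open>The conjugates of a cosine\<close>

text \<open>Reduction to roots of unity. For an \<open>n\<close>-th root of unity \<open>z\<close> the inverse is \<open>z ^ (n - 1)\<close>, so its
  real part is the value at \<open>z\<close> of the rational polynomial \<open>q = (X + X ^ (n - 1)) / 2\<close>, and \<open>p\<close> can be
  replaced by \<open>p \<circ>\<^sub>p q\<close>.\<close>

lemma rpoly_cos_conjugate:
  assumes n: "n > 0" and k: "coprime k n"
    and p: "rpoly.ev p (cos (2 * pi * real j / real n)) = 0"
  shows "rpoly.ev p (cos (2 * pi * real (j * k) / real n)) = 0"
proof -
  let ?c = "\<lambda>i. cos (2 * pi * real i / real n)" and ?z = "\<lambda>i. cis (2 * pi * real i / real n)"
  define q :: "rat poly" where "q = smult (1 / 2) (monom 1 1 + monom 1 (n - 1))"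
  have zn: "?z i ^ n = 1" for i
    using n by (simp add: Complex.DeMoivre cis_multiple_2pi flip: of_nat_mult)
  have q: "rpoly.ev q (?z i) = of_real (?c i)" for i
  proof -
    have "?z i * ?z i ^ (n - 1) = 1" using zn n by (simp add: power_eq_if)
    then have "inverse (?z i) = ?z i ^ (n - 1)" by (rule inverse_unique)
    then show ?thesis
      by (simp add: q_def cos_eq_cis rpoly.ev_smult rpoly.ev_add rpoly.ev_monom of_rat_divide)
  qed
  have qp: "rpoly.ev (p \<circ>\<^sub>p q) (?z i) = of_real (rpoly.ev p (?c i))" for i
    unfolding rpoly.ev_pcompose q rpoly_of_real ..
  have "rpoly.ev (p \<circ>\<^sub>p q) (?z j ^ k) = 0"
    by (rule rpoly_root_conjugate[OF zn n _ k]) (simp add: qp p)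
  moreover have "?z j ^ k = ?z (j * k)" by (simp add: Complex.DeMoivre mult_ac)
  ultimately show ?thesis using qp[of "j * k"] by simp
qed

lemma cos_rational_mod:
  assumes "n > 0"
  shows "cos (2 * pi * real (k mod n) / real n) = cos (2 * pi * real k / real n)"
proof -
  have "real k = real (n * (k div n) + k mod n)" by simp
  then have k: "real k = real n * real (k div n) + real (k mod n)" unfolding of_nat_add of_nat_mult .
  have "2 * pi * real k / real n = 2 * pi * real (k mod n) / real n + 2 * pi * real (k div n)"
    unfolding k using assms by (simp add: field_simps)
  then show ?thesis
    using cos_int_2pin[of "int (k div n)"] sin_int_2pin[of "int (k div n)"] by (simp add: cos_add)
qed

lemma min_poly_cos_roots:
  assumes n: "n > 0" and p: "is_min_poly_rat p (cos (2 * pi / real n))"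
  shows "{z :: complex. rpoly.ev p z = 0} =
           (\<lambda>k. of_real (cos (2 * pi * real k / real n))) ` totatives n"
    (is "?L = ?c ` _")
proof (intro equalityI subsetI)
  have p0: "rpoly.ev p (cos (2 * pi * real 1 / real n)) = 0"
    using min_poly_ratD(3)[OF p] by simp
  fix z assume "z \<in> ?c ` totatives n"
  then obtain k where "k \<in> totatives n" and zk: "z = ?c k" by (elim imageE)
  then have "coprime k n" by (simp add: in_totatives_iff)
  then have "rpoly.ev p z = 0"
    using rpoly_cos_conjugate[OF n _ p0, of k] by (simp only: zk rpoly_of_real mult_1 of_real_0)
  then show "z \<in> ?L" by simp
next
  fix z assume "z \<in> ?L"
  then have z: "rpoly.ev p z = 0" by simp
  have transfer: "rpoly.ev q (cos (2 * pi / real n)) = 0" if "rpoly.ev q z = 0" for q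
    using rpoly_dvd_root[OF min_poly_rat_dvd[OF min_poly_rat_other_root[OF p z] that] min_poly_ratD(3)[OF p]] .
  have "rpoly.ev (chebyshev n - 1) (cos (2 * pi / real n)) = 0"
    using n by (simp add: rpoly.ev_diff ev_chebyshev_cos)
  then have "rpoly.ev (chebyshev n - 1) z = 0"
    using rpoly_dvd_root[OF min_poly_rat_dvd[OF p] z] by blast
  then have "rpoly.ev (chebyshev n) z = 1" by (simp add: rpoly.ev_diff)
  then obtain k where k: "z = ?c k" using chebyshev_eq_1[OF n] by blast
  have "coprime k n"
  proof (rule ccontr)
    assume nc: "\<not> coprime k n"
    define g where "g = gcd k n"
    have "g \<noteq> 1" using nc by (simp add: g_def coprime_iff_gcd_eq_1)
    moreover have "g \<noteq> 0" using n by (simp add: g_def)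
    ultimately have g: "g > 1" by simp
    have "g dvd k" "g dvd n" by (simp_all add: g_def)
    then obtain k' n' where k': "k = g * k'" and n': "n = g * n'" by (elim dvdE)
    have n'0: "n' > 0" using n n' by simp
    have "rpoly.ev (chebyshev n') (cos (2 * pi * real k / real n)) = cos (2 * pi * real k')"
      unfolding ev_chebyshev_cos using g n'0 by (simp add: k' n' mult.assoc)
    also have "\<dots> = 1" using cos_int_2pin[of "int k'"] by simp
    finally have "rpoly.ev (chebyshev n') (cos (2 * pi * real k / real n)) = 1" .
    then have "rpoly.ev (chebyshev n' - 1) z = 0"
      by (simp add: k rpoly_of_real rpoly.ev_diff)
    \<comment> \<open>This is absurd: \<open>n'\<close> times the angle \<open>2\<pi>/n\<close> is not a multiple of \<open>2\<pi>\<close>.\<close>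
    then have "rpoly.ev (chebyshev n' - 1) (cos (2 * pi / real n)) = 0" by (rule transfer)
    then have "cos (real n' * (2 * pi / real n)) = 1" by (simp add: rpoly.ev_diff ev_chebyshev_cos)
    then obtain i :: int where i: "real n' * (2 * pi / real n) = of_int i * 2 * pi"
      unfolding cos_one_2pi_int by blast
    moreover have "real n' * (2 * pi / real n) * real g = 2 * pi" using g n'0 by (simp add: n')
    ultimately have "2 * pi * (real_of_int i * real g) = 2 * pi * 1" by simp
    then have "real_of_int i * real g = 1" by (simp only: mult_cancel_left) simp
    then have "real_of_int (i * int g) = real_of_int 1" by simp
    then have "i * int g = 1" by (simp only: of_int_eq_iff)
    then show False using g by (simp add: zmult_eq_1_iff)
  qed
  then have cm: "coprime (k mod n) n" using n by simp
  have "?c (k mod n) = z" by (simp only: k cos_rational_mod[OF n])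
  \<comment> \<open>The residue 0 is not a totative; it is coprime to \<open>n\<close> only for \<open>n = 1\<close>.\<close>
  show "z \<in> ?c ` totatives n"
  proof (cases "k mod n = 0")
    case True
    then have "n = 1" using cm by simp
    then show ?thesis using \<open>?c (k mod n) = z\<close> by simp
  next
    case False
    then have "k mod n \<in> totatives n" using cm n by (simp add: in_totatives_iff less_imp_le)
    then show ?thesis using \<open>?c (k mod n) = z\<close> by blast
  qed
qed

text \<open>Each pair of totatives \<open>k\<close> and \<open>n - k\<close> has the same cosine. The member below \<open>n / 2\<close> represents the
  pair; on these representatives the angle lies between 0 and \<open>\<pi>\<close>, where the cosine is injective.\<close>

lemma totient_eq_2_card_cos:
  assumes n: "n > 2"
  shows "totient n = 2 * card ((\<lambda>k. complex_of_real (cos (2 * pi * real k / real n))) ` totatives n)"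
    (is "_ = 2 * card (?c ` _)")
proof -
  let ?T = "{k \<in> totatives n. 2 * k < n}" and ?T' = "{k \<in> totatives n. n < 2 * k}"
  have mid: "2 * k \<noteq> n" if "k \<in> totatives n" for k
  proof
    assume "2 * k = n"
    then have "k dvd n" by auto
    then have "is_unit k" using that coprime_common_divisor[of k n k] by (simp add: in_totatives_iff)
    then show False using \<open>2 * k = n\<close> n by simp
  qed
  have reflect: "n - k \<in> totatives n" "?c (n - k) = ?c k" if "k \<in> totatives n" for k
  proof -
    have k: "0 < k" "k < n" "coprime k n"
      using that n totatives_less[of k n] by (auto simp: in_totatives_iff)
    define l where "l = n - k"
    have "n = k + l" using k by (simp add: l_def)
    have "coprime l n"
    proof (rule coprimeI)
      fix c assume "c dvd l" "c dvd n"
      then have "c dvd k" by (simp add: \<open>n = k + l\<close> dvd_add_left_iff)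
      then show "is_unit c" using k(3) \<open>c dvd n\<close> coprime_common_divisor by blast
    qed
    then show "n - k \<in> totatives n" using k by (simp add: in_totatives_iff l_def)
    have "2 * pi * real (n - k) / real n = 2 * pi - 2 * pi * real k / real n"
      using k by (simp add: of_nat_diff field_simps)
    then show "?c (n - k) = ?c k" by simp
  qed
  have U: "totatives n = ?T \<union> ?T'" using mid by (auto simp: neq_iff)
  have "bij_betw (\<lambda>k. n - k) ?T ?T'"
    by (rule bij_betwI[where g = "\<lambda>k. n - k"]) (use reflect(1) totatives_le in \<open>fastforce+\<close>)
  then have "card ?T' = card ?T" by (simp add: bij_betw_same_card)
  moreover have "card (totatives n) = card ?T + card ?T'"
    by (subst U, rule card_Un_disjoint) auto
  ultimately have "totient n = 2 * card ?T" by (simp add: totient_def)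
  moreover have "?c ` totatives n = ?c ` ?T"
  proof -
    have "?c k \<in> ?c ` ?T" if "k \<in> totatives n" for k
    proof (cases "2 * k < n")
      case False
      then have "2 * (n - k) < n" using mid[OF that] totatives_le[OF that] n by arith
      then have "n - k \<in> ?T" using reflect(1)[OF that] by simp
      show ?thesis
        by (rule image_eqI[where x = "n - k"]) (rule reflect(2)[OF that, symmetric], fact)
    qed (use that in auto)
    then show ?thesis by auto
  qed
  moreover have "inj_on ?c ?T"
  proof (rule inj_onI)
    fix k l assume kl: "k \<in> ?T" "l \<in> ?T" "?c k = ?c l"
    have bounds: "0 \<le> 2 * pi * real i / real n" "2 * pi * real i / real n \<le> pi" if "i \<in> ?T" for i
    proof -
      have "real (2 * i) \<le> real n" using that by (intro of_nat_mono) simp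
      then have "pi * real (2 * i) \<le> pi * real n" by (rule mult_left_mono) simp
      then show "2 * pi * real i / real n \<le> pi" using n by (simp add: field_simps)
    qed simp
    have "2 * pi * real k / real n = 2 * pi * real l / real n"
      using kl(3) unfolding of_real_eq_iff
      by (rule cos_inj_pi[OF bounds[OF kl(1)] bounds[OF kl(2)]])
    then show "k = l" using n by simp
  qed
  then have "card (?c ` ?T) = card ?T" by (rule card_image)
  ultimately show ?thesis by simp
qed

section \<open>Small values of the totient function\<close>

text \<open>For all other \<open>n\<close> there is a totative besides \<open>1\<close> and \<open>n - 1\<close>: namely 2 if \<open>n\<close> is odd, and otherwise
  the largest odd number \<open>a\<close> strictly below \<open>n / 2\<close>, which is coprime to \<open>n\<close> because \<open>n - 2 * a\<close> is
  2 or 4.\<close>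

lemma totient_le_2_imp:
  assumes "totient n \<le> 2" "n > 0"
  shows "n \<in> {1, 2, 3, 4, 6}"
proof (rule ccontr)
  assume nn: "n \<notin> {1, 2, 3, 4, 6}"
  have "\<exists>a. a \<noteq> 1 \<and> a \<noteq> n - 1 \<and> a \<in> totatives n"
  proof (cases "odd n")
    case True
    then have "coprime 2 n" by simp
    then show ?thesis using nn assms(2) True by (intro exI[of _ 2]) (auto simp: in_totatives_iff)
  next
    case False
    then obtain h where h: "n = 2 * h" by blast
    define a where "a = (if even h then h - 1 else h - 2)"
    have "h \<noteq> 0" "h \<noteq> 1" "h \<noteq> 2" "h \<noteq> 3" using nn assms(2) h by auto
    then have "h \<ge> 4" by arith
    have "coprime a n"
    proof -
      have "odd a" using \<open>h \<ge> 4\<close> by (auto simp: a_def)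
      then have "coprime a 4" using coprime_power_right_iff[of a 2 2] by simp
      moreover have "gcd a n dvd c" if "n = 2 * a + c" for c
        using that by (metis dvd_add_right_iff gcd_dvd1 gcd_dvd2 dvd_mult)
      then have "gcd a n dvd 4"
      proof -
        have "n = 2 * a + 2 \<or> n = 2 * a + 4" using h \<open>h \<ge> 4\<close> by (auto simp: a_def)
        moreover have "(2::nat) dvd 4" by simp
        ultimately show ?thesis using \<open>\<And>c. n = 2 * a + c \<Longrightarrow> gcd a n dvd c\<close> dvd_trans by blast
      qed
      ultimately have "is_unit (gcd a n)" using coprime_common_divisor gcd_dvd1 by blast
      then show ?thesis by (simp add: coprime_iff_gcd_eq_1)
    qed
    then show ?thesis using h \<open>h \<ge> 4\<close>
      by (intro exI[of _ a]) (auto simp: in_totatives_iff a_def)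
  qed
  then obtain a where a: "a \<noteq> 1" "a \<noteq> n - 1" "a \<in> totatives n" by blast
  have "n > 2" using nn assms(2) by auto
  then have "{1, a, n - 1} \<subseteq> totatives n" using a minus_one_in_totatives[of n] by simp
  then have "card {1, a, n - 1} \<le> totient n" unfolding totient_def by (intro card_mono) auto
  moreover have "card {1, a, n - 1} = 3" using a \<open>n > 2\<close> by auto
  ultimately show False using assms(1) by simp
qed

lemma totient_le_2_iff:
  assumes "n > 0"
  shows "totient n \<le> 2 \<longleftrightarrow> n \<in> {1, 2, 3, 4, 6}"
  using totient_le_2_imp[OF _ assms] by (auto simp: totient_prime)

section \<open>The degree of the cosine of a rational angle\<close>

lemma min_poly_cos_rational_angle:
  assumes n: "n > 0" and k: "coprime k n"
  shows "\<exists>p. is_min_poly_rat p (cos (2 * pi * real k / real n)) \<and>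
             (if n \<le> 2 then degree p = 1 else 2 * degree p = totient n)"
proof -
  have "rpoly.ev (chebyshev n - 1) (cos (2 * pi / real n)) = 0"
    using n by (simp add: rpoly.ev_diff ev_chebyshev_cos)
  then obtain p where p: "is_min_poly_rat p (cos (2 * pi / real n))"
    using min_poly_rat_exists chebyshev_neq_1[OF n] by blast
  then have p0: "rpoly.ev p (cos (2 * pi * real 1 / real n)) = 0" by (simp add: min_poly_ratD(3))
  have "is_min_poly_rat p (cos (2 * pi * real k / real n))"
    using min_poly_rat_other_root[OF p] rpoly_cos_conjugate[OF n k p0] by simp
  moreover have "degree p = 1" if "n \<le> 2"
  proof -
    have "n = 1 \<or> n = 2" using n that by auto
    then have "cos (2 * pi / real n) \<in> \<rat>" by auto
    then show ?thesis using rational_iff_degree_min_poly_1[OF p] by simp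
  qed
  moreover have "2 * degree p = totient n" if "\<not> n \<le> 2"
    using that totient_eq_2_card_cos[of n] degree_min_poly_eq_card_roots[OF p] min_poly_cos_roots[OF n p]
    by simp
  ultimately show ?thesis by auto
qed

lemma cos_rational_angle_nat:
  fixes m n :: int
  assumes n: "n \<noteq> 0" and mn: "coprime m n"
  obtains k :: nat where "coprime k (nat \<bar>n\<bar>)"
    "cos (2 * pi * (of_int m / of_int n)) = cos (2 * pi * real k / real (nat \<bar>n\<bar>))"
proof
  let ?k = "nat \<bar>m\<bar>"
  show "coprime ?k (nat \<bar>n\<bar>)" using mn by (simp add: coprime_nat_abs_left_iff)
  have "2 * pi * real ?k / real (nat \<bar>n\<bar>) = \<bar>2 * pi * (of_int m / of_int n)\<bar>"
    by (simp add: abs_mult)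
  then show "cos (2 * pi * (of_int m / of_int n)) = cos (2 * pi * real ?k / real (nat \<bar>n\<bar>))"
    by (simp only: cos_abs_real)
qed

theorem mainTheorem4:
  fixes m n :: int and \<alpha> :: real
  assumes "n \<noteq> 0" and "coprime m n"
    and "\<alpha> = 2 * pi * (of_int m / of_int n)"
  shows "(cos \<alpha> \<in> \<rat> \<longleftrightarrow> totient (nat \<bar>n\<bar>) \<le> 2) \<and>
         (totient (nat \<bar>n\<bar>) \<le> 2 \<longleftrightarrow> \<bar>n\<bar> \<in> {1, 2, 3, 4, 6}) \<and>
         (\<forall>d::nat. d > 1 \<longrightarrow>
            (algebraic_of_degree (cos \<alpha>) d \<longleftrightarrow> totient (nat \<bar>n\<bar>) = 2 * d))"
proof -
  define N where "N = nat \<bar>n\<bar>"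
  have N: "N > 0" using assms(1) by (simp add: N_def)
  obtain k where k: "coprime k N" and cos: "cos \<alpha> = cos (2 * pi * real k / real N)"
    using cos_rational_angle_nat[OF assms(1,2)] unfolding assms(3) N_def by metis
  obtain p where p: "is_min_poly_rat p (cos \<alpha>)"
    and deg: "if N \<le> 2 then degree p = 1 else 2 * degree p = totient N"
    using min_poly_cos_rational_angle[OF N k] unfolding cos by blast
  have small: "totient N \<le> 2 \<longleftrightarrow> N \<in> {1, 2, 3, 4, 6}" by (rule totient_le_2_iff[OF N])
  have le2: "totient N = 1" if "N \<le> 2"
  proof -
    have "N = 1 \<or> N = 2" using that N by auto
    then show ?thesis by auto
  qed
  have "cos \<alpha> \<in> \<rat> \<longleftrightarrow> totient N \<le> 2"
    using rational_iff_degree_min_poly_1[OF p] deg le2 degree_min_poly_pos[OF p] by (auto split: if_splits)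
  moreover have "totient N \<le> 2 \<longleftrightarrow> \<bar>n\<bar> \<in> {1, 2, 3, 4, 6}"
    unfolding small by (auto simp: N_def)
  moreover have "algebraic_of_degree (cos \<alpha>) d \<longleftrightarrow> totient N = 2 * d" if "d > 1" for d
    unfolding algebraic_of_degree_iff[OF p] using deg le2 that by (cases "N \<le> 2") auto
  ultimately show ?thesis unfolding N_def by blast
qed

end
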